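(* Consider a univariate exponential family of pdfs or pmfs $f(x,\theta)=v(x)\exp(\eta(\theta)u(x)-\zeta(\theta))$, $\theta\in\Theta$, with known functions $u,v,\eta,\zeta$ and $\eta,\zeta$ differentiable. Let $\mu(\theta)=\mathbb{E}_\theta[u(X)]$. Let $X,X_1,\dots,X_n$ be i.i.d. with pdf or pmf $f(\cdot,\theta)$ and $Z=\frac1n\sum_{i=1}^nu(X_i)$. Let $\alpha\in\Theta$ and $z=\mu(\alpha)$. For $\vartheta\in\Theta$ define $\rho(z,\vartheta)=[\eta(\theta)-\eta(\vartheta)]z-\zeta(\theta)+\zeta(\vartheta)$. Let $\mathscr{C}$ be the Berry–Esseen constant and $$\varDelta=\min\Big\{\frac12,\ \frac{\mathscr{C}}{\sqrt n}\,\frac{\mathbb{E}_\alpha[|u(X)-z|^3]}{\mathbb{E}_\alpha^{3/2}[|u(X)-z|^2]}\Big\}.$$ Then: (I) If $\mu(\theta)\le z$ and $\Pr\{u(X)<z\mid\theta\}>0$, then $\Pr\{Z\ge z\mid\theta\}\le\exp(n\rho(z,\alpha))$ and $\lim_{n\to\infty}\frac1n\ln\Pr\{Z\ge z\mid\theta\}=\rho(z,\alpha)$. (II) If $\mu(\theta)\ge z$ and $\Pr\{u(X)>z\mid\theta\}>0$, then $\Pr\{Z\le z\mid\theta\}\le\exp(n\rho(z,\alpha))$ and $\lim_{n\to\infty}\frac1n\ln\Pr\{Z\le z\mid\theta\}=\rho(z,\alpha)$. (III) If $\eta(\theta)\le\eta(\alpha)$, then $\Pr\{Z\ge z\mid\theta\}\le\exp(n\rho(z,\alpha))\Pr\{Z\ge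 z\mid\alpha\}\le(\frac12+\varDelta)\exp(n\rho(z,\alpha))$. (IV) If $\eta(\theta)\ge\eta(\alpha)$, then $\Pr\{Z\le z\mid\theta\}\le\exp(n\rho(z,\alpha))\Pr\{Z\le z\mid\alpha\}\le(\frac12+\varDelta)\exp(n\rho(z,\alpha))$.
   Context: $\mathbb{E}_\alpha$ denotes expectation when $X$ has pdf or pmf $f(\cdot,\alpha)$; $\Pr\{E\mid\theta\}$ is the probability of $E$ when the samples have pdf or pmf $f(\cdot,\theta)$. The Berry–Esseen constant $\mathscr{C}$ is a positive absolute constant such that for every random variable $Y$ with $\mathbb{E}[Y]=0$, $\mathbb{E}[Y^2]>0$, $\mathbb{E}[|Y|^3]<\infty$, every $n$ and every $y\in\mathbb{R}$, $|F_n(y)-\Phi(y)|\le\frac{\mathscr{C}}{\sqrt n}\frac{\mathbb{E}[|Y|^3]}{\mathbb{E}^{3/2}[Y^2]}$, where $F_n$ is the cdf of $\sum_{i=1}^nY_i/\sqrt{n\mathbb{E}[Y^2]}$ for i.i.d. copies $Y_i$ of $Y$ and $\Phi$ is the standard normal cdf. *)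

theory Defs
  imports "HOL-Probability.Probability"
begin

definition Phi :: "real \<Rightarrow> real" where
  "Phi y = measure (density lborel (\<lambda>x. ennreal (std_normal_density x))) {..y}"

definition berry_esseen_const :: "real \<Rightarrow> bool" where
  "berry_esseen_const C \<longleftrightarrow> C > 0 \<and>
     (\<forall>(D::real measure) (n::nat) (y::real).
        prob_space D \<and> sets D = sets borel \<and>
        integrable D (\<lambda>t. \<bar>t\<bar> ^ 3) \<and> integrable D (\<lambda>t. t) \<and> integrable D (\<lambda>t. t\<^sup>2) \<and>
        integral\<^sup>L D (\<lambda>t. t) = 0 \<and> integral\<^sup>L D (\<lambda>t. t\<^sup>2) > 0 \<and> n \<ge> 1
        \<longrightarrow>
        \<bar>measure (PiM {..<n} (\<lambda>_. D))
            {\<omega> \<in> space (PiM {..<n} (\<lambda>_. D)).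
               (\<Sum>i<n. \<omega> i) / sqrt (real n * integral\<^sup>L D (\<lambda>t. t\<^sup>2)) \<le> y}
          - Phi y\<bar>
        \<le> C / sqrt (real n) * (integral\<^sup>L D (\<lambda>t. \<bar>t\<bar> ^ 3) /
                                 (integral\<^sup>L D (\<lambda>t. t\<^sup>2)) powr (3/2)))"

definition ef_pdf :: "(real \<Rightarrow> real) \<Rightarrow> (real \<Rightarrow> real) \<Rightarrow> (real \<Rightarrow> real) \<Rightarrow> (real \<Rightarrow> real)
    \<Rightarrow> real \<Rightarrow> real \<Rightarrow> real" where
  "ef_pdf u v \<eta> \<zeta> t x = v x * exp (\<eta> t * u x - \<zeta> t)"

definition ef_dist :: "real measure \<Rightarrow> (real \<Rightarrow> real) \<Rightarrow> (real \<Rightarrow> real) \<Rightarrow> (real \<Rightarrow> real)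
    \<Rightarrow> (real \<Rightarrow> real) \<Rightarrow> real \<Rightarrow> real measure" where
  "ef_dist M u v \<eta> \<zeta> t = density M (\<lambda>x. ennreal (ef_pdf u v \<eta> \<zeta> t x))"

definition ef_mean :: "real measure \<Rightarrow> (real \<Rightarrow> real) \<Rightarrow> (real \<Rightarrow> real) \<Rightarrow> (real \<Rightarrow> real)
    \<Rightarrow> (real \<Rightarrow> real) \<Rightarrow> real \<Rightarrow> real" where
  "ef_mean M u v \<eta> \<zeta> t = integral\<^sup>L (ef_dist M u v \<eta> \<zeta> t) u"

definition ef_sample :: "real measure \<Rightarrow> (real \<Rightarrow> real) \<Rightarrow> (real \<Rightarrow> real) \<Rightarrow> (real \<Rightarrow> real)
    \<Rightarrow> (real \<Rightarrow> real) \<Rightarrow> nat \<Rightarrow> real \<Rightarrow> (nat \<Rightarrow> real) measure" where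
  "ef_sample M u v \<eta> \<zeta> n t = PiM {..<n} (\<lambda>_. ef_dist M u v \<eta> \<zeta> t)"

definition Zbar :: "(real \<Rightarrow> real) \<Rightarrow> nat \<Rightarrow> (nat \<Rightarrow> real) \<Rightarrow> real" where
  "Zbar u n \<omega> = (\<Sum>i<n. u (\<omega> i)) / real n"

definition Pr_ge :: "real measure \<Rightarrow> (real \<Rightarrow> real) \<Rightarrow> (real \<Rightarrow> real) \<Rightarrow> (real \<Rightarrow> real)
    \<Rightarrow> (real \<Rightarrow> real) \<Rightarrow> nat \<Rightarrow> real \<Rightarrow> real \<Rightarrow> real" where
  "Pr_ge M u v \<eta> \<zeta> n t z = measure (ef_sample M u v \<eta> \<zeta> n t)
      {\<omega> \<in> space (ef_sample M u v \<eta> \<zeta> n t). Zbar u n \<omega> \<ge> z}"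

definition Pr_le :: "real measure \<Rightarrow> (real \<Rightarrow> real) \<Rightarrow> (real \<Rightarrow> real) \<Rightarrow> (real \<Rightarrow> real)
    \<Rightarrow> (real \<Rightarrow> real) \<Rightarrow> nat \<Rightarrow> real \<Rightarrow> real \<Rightarrow> real" where
  "Pr_le M u v \<eta> \<zeta> n t z = measure (ef_sample M u v \<eta> \<zeta> n t)
      {\<omega> \<in> space (ef_sample M u v \<eta> \<zeta> n t). Zbar u n \<omega> \<le> z}"

definition ef_rho :: "(real \<Rightarrow> real) \<Rightarrow> (real \<Rightarrow> real) \<Rightarrow> real \<Rightarrow> real \<Rightarrow> real \<Rightarrow> real" where
  "ef_rho \<eta> \<zeta> t z a = (\<eta> t - \<eta> a) * z - \<zeta> t + \<zeta> a"

text \<open>Delta = min{1/2, C/sqrt n * E_a|u(X)-z|^3 / E_a^{3/2}|u(X)-z|^2}, where the ratio is read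
  as +infinity (so Delta = 1/2) when the third moment is infinite or the second moment vanishes.\<close>
definition ef_Delta :: "real measure \<Rightarrow> (real \<Rightarrow> real) \<Rightarrow> (real \<Rightarrow> real) \<Rightarrow> (real \<Rightarrow> real)
    \<Rightarrow> (real \<Rightarrow> real) \<Rightarrow> real \<Rightarrow> nat \<Rightarrow> real \<Rightarrow> real \<Rightarrow> real" where
  "ef_Delta M u v \<eta> \<zeta> C n a z =
     (let P = ef_dist M u v \<eta> \<zeta> a;
          m3 = integral\<^sup>L P (\<lambda>x. \<bar>u x - z\<bar> ^ 3);
          m2 = integral\<^sup>L P (\<lambda>x. \<bar>u x - z\<bar> ^ 2)
      in if integrable P (\<lambda>x. \<bar>u x - z\<bar> ^ 3) \<and> m2 > 0
         then min (1/2) (C / sqrt (real n) * (m3 / m2 powr (3/2)))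
         else 1/2)"

end

theory Submission
  imports Defs
begin

text \<open>
  With \<open>Y = u - z\<close> and \<open>a = \<eta> \<alpha> - \<eta> \<theta>\<close>, the law at \<open>\<theta>\<close> has density \<open>exp (\<rho> - a * Y)\<close> with respect
  to the law at \<open>\<alpha>\<close>, under which \<open>Y\<close> is centred; so the law of \<open>S = Y\<^sub>1 + \<dots> + Y\<^sub>n\<close> at \<open>\<theta>\<close> has density
  \<open>exp (n * \<rho> - a * s)\<close> with respect to its law at \<open>\<alpha>\<close>. If \<open>a \<ge> 0\<close>, this is at most
  \<open>exp (n * \<rho>)\<close> for \<open>s \<ge> 0\<close>, and Berry-Esseen at \<open>0\<close> bounds the remaining probability. In (I),
  \<open>a < 0\<close> is impossible: a strictly increasing weight strictly increases the mean of a
  nondegenerate \<open>Y\<close>.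

  For the limit it suffices that \<open>Pr {0 \<le> S \<le> n * \<epsilon> | \<alpha>}\<close> decays subexponentially. Only the first
  moment of \<open>Y\<close> is finite, so instead of an exponential weight one uses a density with values in
  \<open>{0..exp \<delta>}\<close> that gives \<open>Y\<close> a mean in \<open>{0<..<\<epsilon>}\<close>. By the weak law of large numbers the event
  becomes almost certain, and removing the density costs a factor of at most \<open>exp (\<delta> * n)\<close>.
  The lower tails follow by replacing \<open>u, \<eta>, z\<close> with their negatives.
\<close>

section \<open>Product measures\<close>

lemma PiM_density:
  fixes g :: "'i \<Rightarrow> 'a \<Rightarrow> ennreal"
  assumes "product_sigma_finite M" and "product_sigma_finite (\<lambda>i. density (M i) (g i))"
    and I: "finite I" and g: "\<And>i. i \<in> I \<Longrightarrow> g i \<in> borel_measurable (M i)"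
  shows "PiM I (\<lambda>i. density (M i) (g i)) = density (PiM I M) (\<lambda>\<omega>. \<Prod>i\<in>I. g i (\<omega> i))"
proof -
  interpret M: product_sigma_finite M by fact
  interpret density: product_sigma_finite "\<lambda>i. density (M i) (g i)" by fact
  note [measurable] = g
  show ?thesis
  proof (rule density.PiM_eqI[OF I, symmetric])
    show "sets (density (PiM I M) (\<lambda>\<omega>. \<Prod>i\<in>I. g i (\<omega> i))) = sets (PiM I (\<lambda>i. density (M i) (g i)))"
      by (simp cong: sets_PiM_cong)
    fix A assume "\<And>i. i \<in> I \<Longrightarrow> A i \<in> sets (density (M i) (g i))"
    then have A [measurable]: "A i \<in> sets (M i)" if "i \<in> I" for i
      using that by simp
    have "emeasure (density (PiM I M) (\<lambda>\<omega>. \<Prod>i\<in>I. g i (\<omega> i))) (Pi\<^sub>E I A)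
        = (\<integral>\<^sup>+\<omega>. (\<Prod>i\<in>I. g i (\<omega> i)) * indicator (Pi\<^sub>E I A) \<omega> \<partial>PiM I M)"
      by (rule emeasure_density) (auto intro!: sets_PiM_I_finite I A)
    also have "\<dots> = (\<integral>\<^sup>+\<omega>. (\<Prod>i\<in>I. g i (\<omega> i) * indicator (A i) (\<omega> i)) \<partial>PiM I M)"
    proof (rule nn_integral_cong)
      fix \<omega> assume "\<omega> \<in> space (PiM I M)"
      then have "indicator (Pi\<^sub>E I A) \<omega> = (\<Prod>i\<in>I. indicator (A i) (\<omega> i) :: ennreal)"
        using I
        by (auto simp: space_PiM PiE_iff indicator_def prod_eq_1_iff[symmetric] intro!: prod_zero)
      then show "(\<Prod>i\<in>I. g i (\<omega> i)) * indicator (Pi\<^sub>E I A) \<omega>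
          = (\<Prod>i\<in>I. g i (\<omega> i) * indicator (A i) (\<omega> i))"
        by (simp add: prod.distrib)
    qed
    also have "\<dots> = (\<Prod>i\<in>I. \<integral>\<^sup>+x. g i x * indicator (A i) x \<partial>M i)"
      by (rule M.product_nn_integral_prod[OF I]) simp
    also have "\<dots> = (\<Prod>i\<in>I. emeasure (density (M i) (g i)) (A i))"
      by (intro prod.cong refl emeasure_density[symmetric]) auto
    finally show "emeasure (density (PiM I M) (\<lambda>\<omega>. \<Prod>i\<in>I. g i (\<omega> i))) (Pi\<^sub>E I A)
        = (\<Prod>i\<in>I. emeasure (density (M i) (g i)) (A i))" .
  qed
qed

lemma
  fixes f :: "'a \<Rightarrow> 'b :: {banach, second_countable_topology}"
  assumes M: "\<And>i. i \<in> I \<Longrightarrow> prob_space (M i)" and i: "i \<in> I" and f: "f \<in> borel_measurable (M i)"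
  shows integral_PiM_component: "(\<integral>\<omega>. f (\<omega> i) \<partial>PiM I M) = integral\<^sup>L (M i) f"
    and integrable_PiM_component_iff: "integrable (PiM I M) (\<lambda>\<omega>. f (\<omega> i)) \<longleftrightarrow> integrable (M i) f"
proof -
  have distr: "distr (PiM I M) (M i) (\<lambda>\<omega>. \<omega> i) = M i"
    by (rule distr_PiM_component) (use M i in auto)
  have "integral\<^sup>L (distr (PiM I M) (M i) (\<lambda>\<omega>. \<omega> i)) f = (\<integral>\<omega>. f (\<omega> i) \<partial>PiM I M)"
    using i f by (intro integral_distr) auto
  then show "(\<integral>\<omega>. f (\<omega> i) \<partial>PiM I M) = integral\<^sup>L (M i) f"
    unfolding distr by (rule sym)
  have "integrable (distr (PiM I M) (M i) (\<lambda>\<omega>. \<omega> i)) f \<longleftrightarrow> integrable (PiM I M) (\<lambda>\<omega>. f (\<omega> i))"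
    using i f by (intro integrable_distr_eq) auto
  then show "integrable (PiM I M) (\<lambda>\<omega>. f (\<omega> i)) \<longleftrightarrow> integrable (M i) f"
    unfolding distr by (rule sym)
qed

lemma indep_vars_PiM_components:
  assumes M: "\<And>i. i \<in> I \<Longrightarrow> prob_space (M i)" and "I \<noteq> {}"
  shows "prob_space.indep_vars (PiM I M) M (\<lambda>i \<omega>. \<omega> i) I"
proof -
  interpret prob_space "PiM I M"
    by (rule prob_space_PiM) (fact M)
  have "distr (PiM I M) (PiM I M) (\<lambda>\<omega>. \<lambda>i\<in>I. \<omega> i) = distr (PiM I M) (PiM I M) (\<lambda>\<omega>. \<omega>)"
    by (rule distr_cong) (auto simp: space_PiM)
  also have "\<dots> = PiM I (\<lambda>i. distr (PiM I M) (M i) (\<lambda>\<omega>. \<omega> i))"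
    by (auto simp: distr_PiM_component M intro!: PiM_cong)
  finally show ?thesis
    using \<open>I \<noteq> {}\<close> by (subst indep_vars_iff_distr_eq_PiM') auto
qed

section \<open>Measures with bounded densities\<close>

lemma (in finite_measure) measure_density_le:
  assumes [measurable]: "g \<in> borel_measurable M" "A \<in> sets M"
    and g: "\<And>x. x \<in> A \<Longrightarrow> g x \<le> c" and "0 \<le> c"
  shows "measure (density M (\<lambda>x. ennreal (g x))) A \<le> c * measure M A"
proof -
  have "emeasure (density M (\<lambda>x. ennreal (g x))) A = (\<integral>\<^sup>+x. ennreal (g x) * indicator A x \<partial>M)"
    by (rule emeasure_density) auto
  also have "\<dots> \<le> (\<integral>\<^sup>+x. ennreal c * indicator A x \<partial>M)"
    by (intro nn_integral_mono) (auto simp: indicator_def g intro!: ennreal_leI)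
  also have "\<dots> = ennreal (c * measure M A)"
    using \<open>0 \<le> c\<close> by (simp add: nn_integral_cmult_indicator emeasure_eq_measure ennreal_mult)
  finally show ?thesis
    using \<open>0 \<le> c\<close> by (simp add: measure_def enn2real_leI)
qed

lemma (in finite_measure) measure_density_ge:
  assumes "finite_measure (density M (\<lambda>x. ennreal (g x)))"
    and [measurable]: "g \<in> borel_measurable M" "A \<in> sets M"
    and g: "\<And>x. x \<in> A \<Longrightarrow> c \<le> g x" and "0 \<le> c"
  shows "c * measure M A \<le> measure (density M (\<lambda>x. ennreal (g x))) A"
proof -
  interpret density: finite_measure "density M (\<lambda>x. ennreal (g x))" by fact
  have "ennreal (c * measure M A) = (\<integral>\<^sup>+x. ennreal c * indicator A x \<partial>M)"
    using \<open>0 \<le> c\<close> by (simp add: nn_integral_cmult_indicator emeasure_eq_measure ennreal_mult)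
  also have "\<dots> \<le> (\<integral>\<^sup>+x. ennreal (g x) * indicator A x \<partial>M)"
    by (intro nn_integral_mono) (auto simp: indicator_def g intro!: ennreal_leI)
  also have "\<dots> = emeasure (density M (\<lambda>x. ennreal (g x))) A"
    by (rule emeasure_density[symmetric]) auto
  finally show ?thesis
    by (simp add: density.emeasure_eq_measure)
qed

section \<open>Sums of independent copies of a random variable\<close>

definition iid_sum_distr :: "'a measure \<Rightarrow> ('a \<Rightarrow> real) \<Rightarrow> nat \<Rightarrow> real measure" where
  "iid_sum_distr M Y n = distr (PiM {..<n} (\<lambda>_. M)) borel (\<lambda>\<omega>. \<Sum>i<n. Y (\<omega> i))"

lemma sets_iid_sum_distr [simp, measurable_cong]: "sets (iid_sum_distr M Y n) = sets borel"
  by (simp add: iid_sum_distr_def)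

lemma space_iid_sum_distr [simp]: "space (iid_sum_distr M Y n) = UNIV"
  by (simp add: iid_sum_distr_def)

lemma measure_iid_sum_distr:
  assumes [measurable]: "Y \<in> borel_measurable M" and "B \<in> sets borel"
  shows "measure (iid_sum_distr M Y n) B
    = measure (PiM {..<n} (\<lambda>_. M)) {\<omega> \<in> space (PiM {..<n} (\<lambda>_. M)). (\<Sum>i<n. Y (\<omega> i)) \<in> B}"
  unfolding iid_sum_distr_def using \<open>B \<in> sets borel\<close>
  by (subst measure_distr) (auto intro!: arg_cong[where f="measure _"])

lemma iid_sum_distr_uminus:
  assumes [measurable]: "Y \<in> borel_measurable M"
  shows "iid_sum_distr M (\<lambda>x. - Y x) n = distr (iid_sum_distr M Y n) borel uminus"
  unfolding iid_sum_distr_def by (subst distr_distr) (auto simp: comp_def sum_negf)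

context prob_space
begin

lemma prob_space_iid_sum_distr:
  assumes [measurable]: "random_variable borel Y"
  shows "prob_space (iid_sum_distr M Y n)"
  unfolding iid_sum_distr_def
  by (intro prob_space.prob_space_distr prob_space_PiM prob_space_axioms) measurable

lemma iid_sum_distr_distr:
  assumes [measurable]: "random_variable N f" "Y \<in> borel_measurable N"
  shows "iid_sum_distr (distr M N f) Y n = iid_sum_distr M (\<lambda>x. Y (f x)) n"
proof -
  have "PiM {..<n} (\<lambda>_. distr M N f) = PiM {..<n} (\<lambda>_. distr M (distr M N f) f)"
    by (intro PiM_cong refl distr_cong) auto
  also have "\<dots> = distr (PiM {..<n} (\<lambda>_. M)) (PiM {..<n} (\<lambda>_. distr M N f)) (compose {..<n} f)"
    by (intro distr_PiM_finite_prob_space'[symmetric] prob_space_distr prob_space_axioms) auto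
  finally have PiM_distr: "PiM {..<n} (\<lambda>_. distr M N f)
      = distr (PiM {..<n} (\<lambda>_. M)) (PiM {..<n} (\<lambda>_. distr M N f)) (compose {..<n} f)" .
  have "compose {..<n} f \<in> measurable (PiM {..<n} (\<lambda>_. M)) (PiM {..<n} (\<lambda>_. distr M N f))"
    unfolding compose_def by measurable
  then show ?thesis
    unfolding iid_sum_distr_def
    by (subst PiM_distr, subst distr_distr) (auto simp: compose_def comp_def intro!: distr_cong)
qed

lemma PiM_density_iid:
  fixes g :: "'a \<Rightarrow> real"
  assumes Q: "prob_space (density M (\<lambda>x. ennreal (g x)))"
    and g: "random_variable borel g" "\<And>x. 0 \<le> g x" and I: "finite (I :: 'i set)"
  shows "PiM I (\<lambda>_. density M (\<lambda>x. ennreal (g x)))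
    = density (PiM I (\<lambda>_. M)) (\<lambda>\<omega>. ennreal (\<Prod>i\<in>I. g (\<omega> i)))"
proof -
  interpret Q: prob_space "density M (\<lambda>x. ennreal (g x))" by fact
  have "product_sigma_finite (\<lambda>_::'i. M)"
    "product_sigma_finite (\<lambda>_::'i. density M (\<lambda>x. ennreal (g x)))"
    by unfold_locales
  then show ?thesis
    using g I by (subst PiM_density) (auto simp: prod_ennreal)
qed

lemma measure_iid_sum_distr_density_le:
  assumes Q: "prob_space (density M (\<lambda>x. ennreal (g x)))"
    and [measurable]: "random_variable borel g" "random_variable borel Y"
    and g: "\<And>x. 0 \<le> g x" "\<And>x. g x \<le> c" and [measurable]: "B \<in> sets borel"
  shows "measure (iid_sum_distr (density M (\<lambda>x. ennreal (g x))) Y n) B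
    \<le> c ^ n * measure (iid_sum_distr M Y n) B"
proof -
  let ?A = "{\<omega> \<in> space (PiM {..<n} (\<lambda>_. M)). (\<Sum>i<n. Y (\<omega> i)) \<in> B}"
  interpret PiM: prob_space "PiM {..<n} (\<lambda>_. M)"
    by (intro prob_space_PiM prob_space_axioms)
  have "0 \<le> c" using g by (rule order_trans)
  have "(\<Prod>i<n. g (\<omega> i)) \<le> c ^ n" for \<omega>
    using prod_mono[of "{..<n}" "\<lambda>i. g (\<omega> i)" "\<lambda>_. c"] g by simp
  then have "measure (density (PiM {..<n} (\<lambda>_. M)) (\<lambda>\<omega>. ennreal (\<Prod>i<n. g (\<omega> i)))) ?A
      \<le> c ^ n * measure (PiM {..<n} (\<lambda>_. M)) ?A"
    using \<open>0 \<le> c\<close> by (intro PiM.measure_density_le) auto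
  then show ?thesis
    by (simp add: measure_iid_sum_distr PiM_density_iid[OF Q] g)
qed

end

section \<open>The weak law of large numbers\<close>

definition mean_deviation_prob :: "'a measure \<Rightarrow> ('a \<Rightarrow> real) \<Rightarrow> nat \<Rightarrow> real \<Rightarrow> real" where
  "mean_deviation_prob M Y n e
    = measure (iid_sum_distr M Y n) {s. real n * e \<le> \<bar>s - real n * integral\<^sup>L M Y\<bar>}"

lemma integral_abs_tail_tendsto_0:
  assumes "integrable M Y"
  shows "(\<lambda>j::nat. \<integral>x. \<bar>Y x * indicator {real j<..} \<bar>Y x\<bar>\<bar> \<partial>M) \<longlonglongrightarrow> 0"
proof -
  have [measurable]: "Y \<in> borel_measurable M" using assms by simp
  have "(\<lambda>j::nat. \<integral>x. \<bar>Y x * indicator {real j<..} \<bar>Y x\<bar>\<bar> \<partial>M) \<longlonglongrightarrow> (\<integral>x. 0 \<partial>M)"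
  proof (rule integral_dominated_convergence)
    have "\<bar>Y x * indicator {real j<..} \<bar>Y x\<bar>\<bar> = 0" if "nat \<lceil>\<bar>Y x\<bar>\<rceil> \<le> j" for x j
      using that by (auto simp: nat_le_iff ceiling_le_iff)
    then show "AE x in M. (\<lambda>j::nat. \<bar>Y x * indicator {real j<..} \<bar>Y x\<bar>\<bar>) \<longlonglongrightarrow> 0"
      by (intro AE_I2 tendsto_eventually eventually_sequentiallyI)
    show "AE x in M. norm \<bar>Y x * indicator {real j<..} \<bar>Y x\<bar>\<bar> \<le> \<bar>Y x\<bar>" for j :: nat
      by (auto simp: indicator_def)
  qed (use assms in auto)
  then show ?thesis by simp
qed

context prob_space
begin

lemma mean_deviation_prob_eq_PiM:
  assumes [measurable]: "random_variable borel Y"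
  shows "mean_deviation_prob M Y n e = measure (PiM {..<n} (\<lambda>_. M))
    {\<omega> \<in> space (PiM {..<n} (\<lambda>_. M)). real n * e \<le> \<bar>(\<Sum>i<n. Y (\<omega> i)) - real n * expectation Y\<bar>}"
  unfolding mean_deviation_prob_def by (subst measure_iid_sum_distr) auto

lemma mean_deviation_prob_add_le:
  assumes X: "integrable M X" and Y: "integrable M Y"
  shows "mean_deviation_prob M (\<lambda>x. X x + Y x) n (d + e)
    \<le> mean_deviation_prob M X n d + mean_deviation_prob M Y n e"
proof -
  have [measurable]: "random_variable borel X" "random_variable borel Y" using X Y by auto
  let ?P = "PiM {..<n} (\<lambda>_. M)"
  let ?far = "\<lambda>X e. {\<omega> \<in> space ?P. real n * e \<le> \<bar>(\<Sum>i<n. X (\<omega> i)) - real n * expectation X\<bar>}"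
  interpret P: prob_space ?P by (intro prob_space_PiM prob_space_axioms)
  have "P.prob (?far (\<lambda>x. X x + Y x) (d + e)) \<le> P.prob (?far X d \<union> ?far Y e)"
    using X Y by (intro P.finite_measure_mono) (auto simp: sum.distrib distrib_left)
  also have "\<dots> \<le> P.prob (?far X d) + P.prob (?far Y e)"
    by (rule measure_Un_le) measurable
  finally show ?thesis
    by (simp add: mean_deviation_prob_eq_PiM)
qed

lemma expectation_abs_centred_le:
  fixes Y :: "'a \<Rightarrow> real"
  assumes Y: "integrable M Y"
  shows "expectation (\<lambda>x. \<bar>Y x - expectation Y\<bar>) \<le> 2 * expectation (\<lambda>x. \<bar>Y x\<bar>)"
proof -
  have "expectation (\<lambda>x. \<bar>Y x - expectation Y\<bar>) \<le> expectation (\<lambda>x. \<bar>Y x\<bar> + \<bar>expectation Y\<bar>)"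
    using Y by (intro integral_mono) auto
  also have "\<dots> = expectation (\<lambda>x. \<bar>Y x\<bar>) + \<bar>expectation Y\<bar>"
    using Y by (simp add: prob_space)
  also have "\<dots> \<le> 2 * expectation (\<lambda>x. \<bar>Y x\<bar>)"
    using integral_abs_bound[of M Y] by simp
  finally show ?thesis .
qed

lemma mean_deviation_prob_le_L1:
  assumes Y: "integrable M Y" and "0 < n" "0 < e"
  shows "mean_deviation_prob M Y n e \<le> 2 * expectation (\<lambda>x. \<bar>Y x\<bar>) / e"
proof -
  let ?P = "PiM {..<n} (\<lambda>_. M)" and ?c = "expectation Y"
  let ?dev = "\<lambda>\<omega>. \<bar>(\<Sum>i<n. Y (\<omega> i)) - real n * ?c\<bar>"
  have [measurable]: "random_variable borel Y" using Y by simp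
  have integrable_centred: "integrable ?P (\<lambda>\<omega>. \<bar>Y (\<omega> i) - ?c\<bar>)" if "i < n" for i
    using that Y prob_space_axioms
    by (subst integrable_PiM_component_iff[where f="\<lambda>x. \<bar>Y x - ?c\<bar>"]) auto
  have dev_le: "?dev \<omega> \<le> (\<Sum>i<n. \<bar>Y (\<omega> i) - ?c\<bar>)" for \<omega>
    using sum_abs[of "\<lambda>i. Y (\<omega> i) - ?c" "{..<n}"] by (simp add: sum_subtractf)
  have integrable_dev: "integrable ?P ?dev"
    by (rule Bochner_Integration.integrable_bound[where f="\<lambda>\<omega>. \<Sum>i<n. \<bar>Y (\<omega> i) - ?c\<bar>"])
       (use integrable_centred dev_le in \<open>auto intro: order_trans[OF _ abs_ge_self]\<close>)
  have "(\<integral>\<omega>. ?dev \<omega> \<partial>?P) \<le> (\<integral>\<omega>. (\<Sum>i<n. \<bar>Y (\<omega> i) - ?c\<bar>) \<partial>?P)"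
    using integrable_dev dev_le integrable_centred by (intro integral_mono) auto
  also have "\<dots> = (\<Sum>i<n. \<integral>\<omega>. \<bar>Y (\<omega> i) - ?c\<bar> \<partial>?P)"
    using integrable_centred by (intro Bochner_Integration.integral_sum) auto
  also have "\<dots> = real n * expectation (\<lambda>x. \<bar>Y x - ?c\<bar>)"
    by (simp add: integral_PiM_component[where f="\<lambda>x. \<bar>Y x - ?c\<bar>"] prob_space_axioms)
  also have "\<dots> \<le> real n * (2 * expectation (\<lambda>x. \<bar>Y x\<bar>))"
    using expectation_abs_centred_le[OF Y] by (intro mult_left_mono) auto
  finally have L1_bound: "(\<integral>\<omega>. ?dev \<omega> \<partial>?P) \<le> real n * (2 * expectation (\<lambda>x. \<bar>Y x\<bar>))" .
  have "mean_deviation_prob M Y n e \<le> (\<integral>\<omega>. ?dev \<omega> \<partial>?P) / (real n * e)"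
    unfolding mean_deviation_prob_eq_PiM[OF \<open>random_variable borel Y\<close>]
    using integrable_dev \<open>0 < n\<close> \<open>0 < e\<close>
    by (intro integral_Markov_inequality_measure[where A="{}"]) auto
  also have "\<dots> \<le> real n * (2 * expectation (\<lambda>x. \<bar>Y x\<bar>)) / (real n * e)"
    using L1_bound \<open>0 < e\<close> by (intro divide_right_mono) auto
  finally show ?thesis
    using \<open>0 < n\<close> by simp
qed

lemma mean_deviation_prob_Hoeffding:
  assumes [measurable]: "random_variable borel Y" and Y: "AE x in M. \<bar>Y x\<bar> \<le> K"
    and "0 < K" "0 < n" "0 \<le> e"
  shows "mean_deviation_prob M Y n e \<le> 2 * exp (- (e\<^sup>2 / (2 * K\<^sup>2)) * real n)"
proof -
  let ?P = "PiM {..<n} (\<lambda>_. M)"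
  interpret P: prob_space ?P by (intro prob_space_PiM prob_space_axioms)
  have sum_expectation: "(\<Sum>i<n. P.expectation (\<lambda>\<omega>. Y (\<omega> i))) = real n * expectation Y"
    by (simp add: integral_PiM_component[where f=Y] prob_space_axioms)
  interpret Hoeffding_ineq ?P "{..<n}" "\<lambda>i \<omega>. Y (\<omega> i)" "\<lambda>_. - K" "\<lambda>_. K"
    "\<Sum>i<n. P.expectation (\<lambda>\<omega>. Y (\<omega> i))"
  proof unfold_locales
    show "P.indep_vars (\<lambda>_. borel) (\<lambda>i \<omega>. Y (\<omega> i)) {..<n}"
      using \<open>0 < n\<close> prob_space_axioms
      by (intro P.indep_vars_compose2[OF indep_vars_PiM_components]) auto
    show "AE \<omega> in ?P. Y (\<omega> i) \<in> {- K..K}" if "i \<in> {..<n}" for i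
    proof (rule AE_PiM_component)
      show "AE x in M. Y x \<in> {- K..K}"
        using Y by eventually_elim auto
    qed (use that prob_space_axioms in auto)
  qed simp_all
  have "mean_deviation_prob M Y n e \<le> 2 * exp (- 2 * (real n * e)\<^sup>2 / (\<Sum>i<n. (K - - K)\<^sup>2))"
    using Hoeffding_ineq_abs_ge[of "real n * e"] \<open>0 < K\<close> \<open>0 < n\<close> \<open>0 \<le> e\<close>
    unfolding sum_expectation by (simp add: mean_deviation_prob_eq_PiM)
  also have "- 2 * (real n * e)\<^sup>2 / (\<Sum>i<n. (K - - K)\<^sup>2) = - (e\<^sup>2 / (2 * K\<^sup>2)) * real n"
    using \<open>0 < K\<close> \<open>0 < n\<close> by (simp add: field_simps power2_eq_square)
  finally show ?thesis .
qed

lemma mean_deviation_prob_bounded_tendsto_0: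
  assumes "random_variable borel Y" and "AE x in M. \<bar>Y x\<bar> \<le> K" and "0 < K" "0 < e"
  shows "(\<lambda>n. mean_deviation_prob M Y n e) \<longlonglongrightarrow> 0"
proof (rule tendsto_sandwich[OF _ _ tendsto_const])
  show "\<forall>\<^sub>F n in sequentially. mean_deviation_prob M Y n e \<le> 2 * exp (- (e\<^sup>2 / (2 * K\<^sup>2)) * real n)"
    using eventually_gt_at_top[of 0]
    by eventually_elim (rule mean_deviation_prob_Hoeffding, use assms in auto)
  show "(\<lambda>n. 2 * exp (- (e\<^sup>2 / (2 * K\<^sup>2)) * real n)) \<longlonglongrightarrow> 0"
    using \<open>0 < K\<close> \<open>0 < e\<close> by real_asymp
qed (simp_all add: mean_deviation_prob_def)

theorem weak_law_of_large_numbers: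
  assumes Y: "integrable M Y" and e: "0 < e"
  shows "(\<lambda>n. mean_deviation_prob M Y n e) \<longlonglongrightarrow> 0"
proof (rule tendstoI)
  fix \<eta> :: real assume \<eta>: "0 < \<eta>"
  have [measurable]: "random_variable borel Y" using Y by simp
  have "0 < \<eta> * e / 8" using \<eta> e by simp
  from eventually_gt_at_top[of 0] order_tendstoD(2)[OF integral_abs_tail_tendsto_0[OF Y] this]
  have "\<forall>\<^sub>F j in sequentially. 0 < j \<and>
      expectation (\<lambda>x. \<bar>Y x * indicator {real j<..} \<bar>Y x\<bar>\<bar>) < \<eta> * e / 8"
    by (rule eventually_conj)
  then obtain j :: nat where "0 < j"
    and j: "expectation (\<lambda>x. \<bar>Y x * indicator {real j<..} \<bar>Y x\<bar>\<bar>) < \<eta> * e / 8"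
    by (auto dest: eventually_happens)
  define bulk where "bulk x = Y x * indicator {..real j} \<bar>Y x\<bar>" for x
  define tail where "tail x = Y x * indicator {real j<..} \<bar>Y x\<bar>" for x
  have [measurable]: "random_variable borel bulk" "random_variable borel tail"
    unfolding bulk_def tail_def by measurable
  have integrable: "integrable M bulk" "integrable M tail"
    by (rule Bochner_Integration.integrable_bound[OF Y];
        auto simp: bulk_def tail_def indicator_def)+
  have bulk: "\<bar>bulk x\<bar> \<le> real j" for x
    by (auto simp: bulk_def indicator_def)
  have split: "Y = (\<lambda>x. bulk x + tail x)"
    by (auto simp: bulk_def tail_def indicator_def)
  have "(\<lambda>n. mean_deviation_prob M bulk n (e / 2)) \<longlonglongrightarrow> 0"
    using bulk \<open>0 < j\<close> e by (intro mean_deviation_prob_bounded_tendsto_0[where K="real j"]) auto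
  then have "\<forall>\<^sub>F n in sequentially. mean_deviation_prob M bulk n (e / 2) < \<eta> / 2"
    by (rule order_tendstoD) (use \<eta> in simp)
  then show "\<forall>\<^sub>F n in sequentially. dist (mean_deviation_prob M Y n e) 0 < \<eta>"
    using eventually_gt_at_top[of 0]
  proof eventually_elim
    case (elim n)
    have "mean_deviation_prob M tail n (e / 2) \<le> 2 * expectation (\<lambda>x. \<bar>tail x\<bar>) / (e / 2)"
      using integrable elim e by (intro mean_deviation_prob_le_L1) auto
    also have "\<dots> < \<eta> / 2"
      using j e by (simp add: tail_def field_simps)
    finally have "mean_deviation_prob M bulk n (e / 2) + mean_deviation_prob M tail n (e / 2) < \<eta>"
      using elim by simp
    then have "mean_deviation_prob M Y n e < \<eta>"
      using mean_deviation_prob_add_le[OF integrable, of n "e / 2" "e / 2"]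
      unfolding split[symmetric] by simp
    then show ?case
      by (simp add: mean_deviation_prob_def)
  qed
qed

end

section \<open>Small positive values of centred sums\<close>

context prob_space
begin

lemma expectation_max_0_pos:
  fixes Y :: "'a \<Rightarrow> real"
  assumes Y: "integrable M Y" and mean: "expectation Y = 0" and nondeg: "\<not> (AE x in M. Y x = 0)"
  shows "0 < expectation (\<lambda>x. max 0 (Y x))"
proof (rule ccontr)
  have max_Y: "integrable M (\<lambda>x. max 0 (Y x))" using Y by simp
  assume "\<not> 0 < expectation (\<lambda>x. max 0 (Y x))"
  then have "expectation (\<lambda>x. max 0 (Y x)) = 0"
    by (simp add: antisym)
  then have "AE x in M. max 0 (Y x) = 0"
    using integral_nonneg_eq_0_iff_AE[OF max_Y] by simp
  then have nonpos: "AE x in M. 0 \<le> - Y x"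
    by eventually_elim auto
  have "AE x in M. - Y x = 0"
    using integral_nonneg_eq_0_iff_AE[OF _ nonpos] Y mean by simp
  then show False using nondeg by simp
qed

lemma
  assumes [measurable]: "random_variable borel f" and f: "\<And>x. f x \<in> {0..1}" and \<tau>: "\<tau> \<in> {0..1}"
  shows centred_perturbation_bounds: "1 + \<tau> * (f x - expectation f) \<in> {0..1 + \<tau>}"
    and prob_space_density_centred_perturbation:
      "prob_space (density M (\<lambda>x. ennreal (1 + \<tau> * (f x - expectation f))))"
proof -
  have integrable: "integrable M f"
    by (rule integrable_const_bound[of _ 1]) (use f in auto)
  have expectation_f: "expectation f \<in> {0..1}"
    using f integral_le_const[OF integrable, of 1] by auto
  have bounds: "1 + \<tau> * (f x - expectation f) \<in> {0..1 + \<tau>}" for x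
  proof -
    have "\<bar>f x - expectation f\<bar> \<le> 1"
      using f[of x] expectation_f by auto
    then have "\<bar>\<tau> * (f x - expectation f)\<bar> \<le> \<tau> * 1"
      unfolding abs_mult using \<tau> by (intro mult_mono) auto
    then show ?thesis using \<tau> by (auto simp: abs_le_iff)
  qed
  then show "1 + \<tau> * (f x - expectation f) \<in> {0..1 + \<tau>}" .
  have "(\<integral>\<^sup>+x. ennreal (1 + \<tau> * (f x - expectation f)) \<partial>M)
      = ennreal (expectation (\<lambda>x. 1 + \<tau> * (f x - expectation f)))"
    using integrable bounds by (intro nn_integral_eq_integral) auto
  also have "expectation (\<lambda>x. 1 + \<tau> * (f x - expectation f)) = 1"
    using integrable by (simp add: prob_space)
  finally show "prob_space (density M (\<lambda>x. ennreal (1 + \<tau> * (f x - expectation f))))"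
    by (intro prob_spaceI) (simp add: emeasure_density cong: nn_integral_cong)
qed

lemma exists_density_small_positive_mean:
  fixes Y :: "'a \<Rightarrow> real"
  assumes Y: "integrable M Y" and mean: "expectation Y = 0" and nondeg: "\<not> (AE x in M. Y x = 0)"
    and \<epsilon>: "0 < \<epsilon>" and \<delta>: "0 < \<delta>"
  obtains h where "random_variable borel h" "\<And>x. 0 \<le> h x" "\<And>x. h x \<le> exp \<delta>"
    "prob_space (density M (\<lambda>x. ennreal (h x)))"
    "integrable (density M (\<lambda>x. ennreal (h x))) Y"
    "0 < (\<integral>x. Y x \<partial>density M (\<lambda>x. ennreal (h x)))" "(\<integral>x. Y x \<partial>density M (\<lambda>x. ennreal (h x))) < \<epsilon>"
proof -
  have [measurable]: "random_variable borel Y" using Y by simp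
  define p where "p = expectation (\<lambda>x. max 0 (Y x))"
  have p: "0 < p" unfolding p_def by (rule expectation_max_0_pos) fact+
  define \<tau> where "\<tau> = min 1 (min \<delta> (\<epsilon> / (2 * p)))"
  have \<tau>: "0 < \<tau>" "\<tau> \<in> {0..1}" "\<tau> \<le> \<delta>" "\<tau> \<le> \<epsilon> / (2 * p)"
    using \<delta> \<epsilon> p by (auto simp: \<tau>_def)
  \<comment> \<open>Moving mass to \<open>{Y > 0}\<close> raises the mean of \<open>Y\<close> from \<open>0\<close> to \<open>\<tau> * p\<close>.\<close>
  define f :: "'a \<Rightarrow> real" where "f x = indicator {0<..} (Y x)" for x
  define h where "h x = 1 + \<tau> * (f x - expectation f)" for x
  have f: "random_variable borel f" "f x \<in> {0..1}" for x
    by (auto simp: f_def[abs_def] indicator_def)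
  have [measurable]: "random_variable borel h" using f unfolding h_def by measurable
  have prob: "prob_space (density M (\<lambda>x. ennreal (h x)))"
    unfolding h_def using f \<tau> by (intro prob_space_density_centred_perturbation) auto
  have bounds: "h x \<in> {0..1 + \<tau>}" for x
    unfolding h_def using f \<tau> by (intro centred_perturbation_bounds) auto
  have h_le: "h x \<le> exp \<delta>" for x
  proof -
    have "h x \<le> 1 + \<delta>" using bounds[of x] \<tau> by simp
    also have "\<dots> \<le> exp \<delta>" by (rule exp_ge_add_one_self)
    finally show ?thesis .
  qed
  have h_Y: "h x * Y x = (1 - \<tau> * expectation f) * Y x + \<tau> * max 0 (Y x)" for x
    by (auto simp: h_def f_def indicator_def algebra_simps)
  have integrable_h_Y: "integrable (density M (\<lambda>x. ennreal (h x))) Y"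
    using Y bounds by (simp add: integrable_density h_Y)
  have mean_h: "(\<integral>x. Y x \<partial>density M (\<lambda>x. ennreal (h x))) = \<tau> * p"
    using Y bounds by (simp add: integral_density h_Y mean p_def)
  have "\<tau> * p \<le> \<epsilon> / (2 * p) * p"
    using \<tau> p by (intro mult_right_mono) auto
  also have "\<dots> < \<epsilon>" using p \<epsilon> by simp
  finally show thesis
    using that[of h] bounds h_le prob integrable_h_Y mean_h \<tau> p by simp
qed

lemma iid_sum_positive_mean_concentrated:
  assumes Y: "integrable M Y" and mean: "0 < expectation Y" "expectation Y < \<epsilon>"
  shows "(\<lambda>n. measure (iid_sum_distr M Y n) {0..real n * \<epsilon>}) \<longlonglongrightarrow> 1"
proof (rule tendsto_sandwich[OF always_eventually always_eventually _ tendsto_const])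
  define e where "e = min (expectation Y) (\<epsilon> - expectation Y)"
  have e: "0 < e" using mean by (simp add: e_def)
  have [measurable]: "random_variable borel Y" using Y by simp
  show "(\<lambda>n. 1 - mean_deviation_prob M Y n e) \<longlonglongrightarrow> 1"
    using tendsto_diff[OF tendsto_const weak_law_of_large_numbers[OF Y e]] by simp
  show "\<forall>n. 1 - mean_deviation_prob M Y n e \<le> measure (iid_sum_distr M Y n) {0..real n * \<epsilon>}"
  proof
    fix n
    interpret S: prob_space "iid_sum_distr M Y n"
      by (rule prob_space_iid_sum_distr) simp
    let ?far = "{s. real n * e \<le> \<bar>s - real n * expectation Y\<bar>}"
    have "1 - mean_deviation_prob M Y n e = S.prob (space (iid_sum_distr M Y n) - ?far)"
      unfolding mean_deviation_prob_def by (intro S.prob_compl[symmetric]) measurable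
    also have "\<dots> \<le> S.prob {0..real n * \<epsilon>}"
    proof (rule S.finite_measure_mono)
      have "real n * e \<le> real n * expectation Y" "real n * e \<le> real n * (\<epsilon> - expectation Y)"
        unfolding e_def by (intro mult_left_mono; simp)+
      then show "space (iid_sum_distr M Y n) - ?far \<subseteq> {0..real n * \<epsilon>}"
        by (auto simp: right_diff_distrib)
    qed simp
    finally show "1 - mean_deviation_prob M Y n e \<le> S.prob {0..real n * \<epsilon>}" .
  qed
  show "\<forall>n. measure (iid_sum_distr M Y n) {0..real n * \<epsilon>} \<le> 1"
    by (simp add: prob_space.prob_le_1 prob_space_iid_sum_distr)
qed

theorem iid_sum_small_positive_subexponential:
  assumes Y: "integrable M Y" and mean: "expectation Y = 0" and nondeg: "\<not> (AE x in M. Y x = 0)"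
    and \<epsilon>: "0 < \<epsilon>" and \<delta>: "0 < \<delta>"
  shows "\<forall>\<^sub>F n in sequentially.
    exp (- (real n * \<delta>)) \<le> measure (iid_sum_distr M Y n) {0..real n * \<epsilon>}"
proof -
  have [measurable]: "random_variable borel Y" using Y by simp
  have "0 < \<delta> / 2" using \<delta> by simp
  from exists_density_small_positive_mean[OF Y mean nondeg \<epsilon> this]
  obtain h where h: "random_variable borel h" "\<And>x. 0 \<le> h x" "\<And>x. h x \<le> exp (\<delta> / 2)"
    and prob_h: "prob_space (density M (\<lambda>x. ennreal (h x)))"
    and Y_h: "integrable (density M (\<lambda>x. ennreal (h x))) Y"
      "0 < (\<integral>x. Y x \<partial>density M (\<lambda>x. ennreal (h x)))"
      "(\<integral>x. Y x \<partial>density M (\<lambda>x. ennreal (h x))) < \<epsilon>"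
    by blast
  define Q where "Q = density M (\<lambda>x. ennreal (h x))"
  interpret Q: prob_space Q unfolding Q_def by (rule prob_h)
  let ?E = "\<lambda>n. {0..real n * \<epsilon>}"
  have "(\<lambda>n. exp (- (real n * (\<delta> / 2)))) \<longlonglongrightarrow> 0"
    using \<delta> by real_asymp
  then have "\<forall>\<^sub>F n in sequentially. exp (- (real n * (\<delta> / 2))) < 1 / 2"
    by (rule order_tendstoD) simp
  moreover have "(\<lambda>n. measure (iid_sum_distr Q Y n) (?E n)) \<longlonglongrightarrow> 1"
    using Y_h by (intro Q.iid_sum_positive_mean_concentrated) (simp_all add: Q_def)
  then have "\<forall>\<^sub>F n in sequentially. 1 / 2 < measure (iid_sum_distr Q Y n) (?E n)"
    by (rule order_tendstoD) simp
  ultimately show ?thesis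
  proof eventually_elim
    case (elim n)
    have "exp (- (real n * (\<delta> / 2))) \<le> measure (iid_sum_distr Q Y n) (?E n)"
      using elim by simp
    also have "\<dots> \<le> exp (\<delta> / 2) ^ n * measure (iid_sum_distr M Y n) (?E n)"
      unfolding Q_def using h by (intro measure_iid_sum_distr_density_le prob_h) auto
    also have "exp (\<delta> / 2) ^ n = exp (real n * (\<delta> / 2))"
      by (rule exp_of_nat_mult[symmetric])
    finally have "exp (- (real n * (\<delta> / 2))) * exp (- (real n * (\<delta> / 2)))
        \<le> measure (iid_sum_distr M Y n) (?E n)"
      by (simp add: exp_minus field_simps)
    then show ?case
      by (simp add: mult_exp_exp mult.commute)
  qed
qed

end

section \<open>Exponential change of measure\<close>

lemma tendsto_ln_over_n_if_exp_bounds: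
  fixes q :: "nat \<Rightarrow> real"
  assumes upper: "\<forall>\<^sub>F n in sequentially. q n \<le> exp (real n * r)"
    and lower: "\<And>\<gamma>. 0 < \<gamma> \<Longrightarrow> \<forall>\<^sub>F n in sequentially. exp (real n * (r - \<gamma>)) \<le> q n"
  shows "(\<lambda>n. ln (q n) / real n) \<longlonglongrightarrow> r"
proof (rule tendstoI)
  fix \<gamma> :: real assume \<gamma>: "0 < \<gamma>"
  then have "0 < \<gamma> / 2" by simp
  from upper lower[OF this] eventually_gt_at_top[of 0]
  show "\<forall>\<^sub>F n in sequentially. dist (ln (q n) / real n) r < \<gamma>"
  proof eventually_elim
    case (elim n)
    have "0 < q n" using elim by (meson exp_gt_zero less_le_trans)
    then have "ln (q n) \<le> real n * r" "real n * (r - \<gamma> / 2) \<le> ln (q n)"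
      using elim ln_mono[of "q n" "exp (real n * r)"] by (simp_all add: ln_ge_iff)
    then have "ln (q n) / real n \<le> r" "r - \<gamma> / 2 \<le> ln (q n) / real n"
      using elim by (simp_all add: pos_divide_le_eq pos_le_divide_eq mult.commute)
    then show ?case using \<gamma> by (simp add: dist_real_def)
  qed
qed

definition exp_tilt :: "'a measure \<Rightarrow> ('a \<Rightarrow> real) \<Rightarrow> real \<Rightarrow> real \<Rightarrow> 'a measure" where
  "exp_tilt M Y a r = density M (\<lambda>x. ennreal (exp (r - a * Y x)))"

lemma sets_exp_tilt [simp, measurable_cong]: "sets (exp_tilt M Y a r) = sets M"
  by (simp add: exp_tilt_def)

context prob_space
begin

lemma expectation_mult_strict_mono_pos:
  fixes Y :: "'a \<Rightarrow> real" and g :: "real \<Rightarrow> real"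
  assumes Y: "integrable M Y" and mean: "expectation Y = 0" and nondeg: "\<not> (AE x in M. Y x = 0)"
    and g: "strict_mono g" and integrable: "integrable M (\<lambda>x. g (Y x) * Y x)"
  shows "0 < expectation (\<lambda>x. g (Y x) * Y x)"
proof -
  let ?f = "\<lambda>x. (g (Y x) - g 0) * Y x"
  have nonneg: "0 \<le> (g y - g 0) * y" and eq_0_iff: "(g y - g 0) * y = 0 \<longleftrightarrow> y = 0" for y
    using strict_monoD[OF g, of y 0] strict_monoD[OF g, of 0 y] linorder_less_linear[of y 0]
    by (auto simp: zero_le_mult_iff)
  have f: "integrable M ?f"
    using Y integrable by (simp add: left_diff_distrib)
  have "expectation ?f \<noteq> 0"
    using integral_nonneg_eq_0_iff_AE[OF f AE_I2[OF nonneg], unfolded eq_0_iff] nondeg by blast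
  moreover have "0 \<le> expectation ?f"
    using nonneg by simp
  moreover have "expectation ?f = expectation (\<lambda>x. g (Y x) * Y x)"
    using Y integrable mean by (simp add: left_diff_distrib)
  ultimately show ?thesis by simp
qed

lemma iid_sum_distr_exp_tilt:
  assumes Q: "prob_space (exp_tilt M Y a r)" and [measurable]: "random_variable borel Y"
  shows "iid_sum_distr (exp_tilt M Y a r) Y n
    = exp_tilt (iid_sum_distr M Y n) (\<lambda>s. s) a (real n * r)"
proof -
  have "(\<Prod>i<n. exp (r - a * Y (\<omega> i))) = exp (real n * r - a * (\<Sum>i<n. Y (\<omega> i)))" for \<omega> :: "nat \<Rightarrow> 'a"
    by (simp add: exp_sum[symmetric] sum_subtractf sum_distrib_left)
  then show ?thesis
    unfolding iid_sum_distr_def exp_tilt_def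
    by (subst PiM_density_iid[OF Q[unfolded exp_tilt_def]]) (auto simp: density_distr)
qed

lemma exp_tilt_upper_tail_le:
  assumes Q: "prob_space (exp_tilt M Y a r)"
    and [measurable]: "random_variable borel Y" and a: "0 \<le> a"
  shows "measure (iid_sum_distr (exp_tilt M Y a r) Y n) {s..}
    \<le> exp (real n * r - a * s) * measure (iid_sum_distr M Y n) {s..}"
proof -
  interpret S: prob_space "iid_sum_distr M Y n"
    by (rule prob_space_iid_sum_distr) simp
  show ?thesis
    unfolding iid_sum_distr_exp_tilt[OF Q \<open>random_variable borel Y\<close>] unfolding exp_tilt_def
    using a by (intro S.measure_density_le) (auto intro: mult_left_mono)
qed

lemma exp_tilt_interval_ge:
  assumes Q: "prob_space (exp_tilt M Y a r)"
    and [measurable]: "random_variable borel Y" and a: "0 \<le> a"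
  shows "exp (real n * r - a * t) * measure (iid_sum_distr M Y n) {s..t}
    \<le> measure (iid_sum_distr (exp_tilt M Y a r) Y n) {s..t}"
proof -
  interpret S: prob_space "iid_sum_distr M Y n"
    by (rule prob_space_iid_sum_distr) simp
  have "prob_space (iid_sum_distr (exp_tilt M Y a r) Y n)"
    by (rule prob_space.prob_space_iid_sum_distr[OF Q]) simp
  then show ?thesis
    unfolding iid_sum_distr_exp_tilt[OF Q \<open>random_variable borel Y\<close>] unfolding exp_tilt_def
    using a by (intro S.measure_density_ge) (auto intro: mult_left_mono simp: prob_space_def)
qed

theorem exp_tilt_upper_tail_log_limit:
  assumes Q: "prob_space (exp_tilt M Y a r)" and a: "0 \<le> a"
    and Y: "integrable M Y" and mean: "expectation Y = 0" and nondeg: "\<not> (AE x in M. Y x = 0)"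
  shows "(\<lambda>n. ln (measure (iid_sum_distr (exp_tilt M Y a r) Y n) {0..}) / real n) \<longlonglongrightarrow> r"
    (is "(\<lambda>n. ln (measure (?Q n) {0..}) / real n) \<longlonglongrightarrow> r")
proof (rule tendsto_ln_over_n_if_exp_bounds)
  have [measurable]: "random_variable borel Y" using Y by simp
  have "measure (?Q n) {0..} \<le> exp (real n * r)" for n
  proof -
    have "measure (?Q n) {0..} \<le> exp (real n * r) * measure (iid_sum_distr M Y n) {0..}"
      using exp_tilt_upper_tail_le[OF Q _ a, of n 0] by simp
    also have "\<dots> \<le> exp (real n * r)"
      by (simp add: prob_space.prob_le_1 prob_space_iid_sum_distr)
    finally show ?thesis .
  qed
  then show "\<forall>\<^sub>F n in sequentially. measure (?Q n) {0..} \<le> exp (real n * r)"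
    by simp
  fix \<gamma> :: real assume \<gamma>: "0 < \<gamma>"
  define \<epsilon> where "\<epsilon> = \<gamma> / (2 * (a + 1))"
  have \<epsilon>: "0 < \<epsilon>" "a * \<epsilon> \<le> \<gamma> / 2"
    using \<gamma> a by (simp_all add: \<epsilon>_def field_simps)
  have "0 < \<gamma> / 2" using \<gamma> by simp
  from iid_sum_small_positive_subexponential[OF Y mean nondeg \<epsilon>(1) this]
  show "\<forall>\<^sub>F n in sequentially. exp (real n * (r - \<gamma>)) \<le> measure (?Q n) {0..}"
  proof eventually_elim
    case (elim n)
    interpret Q_sum: prob_space "?Q n"
      by (rule prob_space.prob_space_iid_sum_distr[OF Q]) simp
    have "real n * (a * \<epsilon>) \<le> real n * (\<gamma> / 2)"
      using \<epsilon> by (intro mult_left_mono) auto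
    then have "exp (real n * (r - \<gamma>))
        \<le> exp (real n * r - a * (real n * \<epsilon>)) * exp (- (real n * (\<gamma> / 2)))"
      by (simp add: mult_exp_exp algebra_simps)
    also have "\<dots> \<le> exp (real n * r - a * (real n * \<epsilon>))
        * measure (iid_sum_distr M Y n) {0..real n * \<epsilon>}"
      using elim by (intro mult_left_mono) auto
    also have "\<dots> \<le> Q_sum.prob {0..real n * \<epsilon>}"
      by (rule exp_tilt_interval_ge[OF Q _ a]) simp
    also have "\<dots> \<le> Q_sum.prob {0..}"
      by (intro Q_sum.finite_measure_mono) auto
    finally show ?case .
  qed
qed

end

section \<open>The Berry-Esseen bound\<close>

lemma Phi_uminus: "Phi (- y) = 1 - Phi y"
proof -
  let ?N = std_normal_distribution
  interpret N: prob_space ?N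
    by (rule prob_space_normal_density) simp
  have "distr ?N borel uminus
      = density (distr lborel borel uminus) (\<lambda>x. ennreal (std_normal_density x))"
    by (subst density_distr) (simp_all add: normal_density_def)
  then have symmetric: "distr ?N borel uminus = ?N"
    by (simp add: lborel_distr_uminus)
  have "Phi (- y) = measure (distr ?N borel uminus) {..- y}"
    by (simp add: Phi_def symmetric)
  also have "\<dots> = N.prob (UNIV - {..<y})"
    by (subst measure_distr) (auto intro!: arg_cong[where f=N.prob])
  also have "\<dots> = 1 - N.prob {..<y}"
    using N.prob_compl[of "{..<y}"] by simp
  also have "N.prob {..<y} = N.prob {..y}"
  proof (rule N.finite_measure_eq_AE)
    have "AE x in lborel. x \<noteq> y"
      by (rule AE_lborel_singleton)
    then show "AE x in ?N. x \<in> {..<y} \<longleftrightarrow> x \<in> {..y}"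
      by (subst AE_density) auto
  qed auto
  finally show ?thesis by (simp add: Phi_def)
qed

definition lyapunov_ratio :: "'a measure \<Rightarrow> ('a \<Rightarrow> real) \<Rightarrow> real" where
  "lyapunov_ratio M Y = (\<integral>x. \<bar>Y x\<bar> ^ 3 \<partial>M) / (\<integral>x. (Y x)\<^sup>2 \<partial>M) powr (3 / 2)"

context prob_space
begin

lemma berry_esseen_iid_sum:
  assumes BE: "berry_esseen_const C" and n: "1 \<le> n"
    and [measurable]: "random_variable borel Y" and mean: "expectation Y = 0"
    and Y3: "integrable M (\<lambda>x. \<bar>Y x\<bar> ^ 3)" and var: "0 < expectation (\<lambda>x. (Y x)\<^sup>2)"
  shows "\<bar>measure (iid_sum_distr M Y n) {..y * sqrt (real n * expectation (\<lambda>x. (Y x)\<^sup>2))} - Phi y\<bar>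
    \<le> C / sqrt (real n) * lyapunov_ratio M Y"
proof -
  have Y2: "integrable M (\<lambda>x. (Y x)\<^sup>2)"
    using var not_integrable_integral_eq by fastforce
  then have Y: "integrable M Y"
    by (rule square_integrable_imp_integrable[rotated]) simp
  define D where "D = distr M borel Y"
  interpret D: prob_space D unfolding D_def by (rule prob_space_distr) simp
  have sets_D [simp, measurable_cong]: "sets D = sets borel" by (simp add: D_def)
  have moments: "D.expectation (\<lambda>t. t) = 0" "D.expectation (\<lambda>t. t\<^sup>2) = expectation (\<lambda>x. (Y x)\<^sup>2)"
      "D.expectation (\<lambda>t. \<bar>t\<bar> ^ 3) = expectation (\<lambda>x. \<bar>Y x\<bar> ^ 3)"
    unfolding D_def using mean by (simp_all add: integral_distr)
  have integrable: "integrable D (\<lambda>t. t)" "integrable D (\<lambda>t. t\<^sup>2)" "integrable D (\<lambda>t. \<bar>t\<bar> ^ 3)"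
    unfolding D_def using Y Y2 Y3 by (simp_all add: integrable_distr_eq)
  let ?s = "sqrt (real n * D.expectation (\<lambda>t. t\<^sup>2))"
  have "0 < D.expectation (\<lambda>t. t\<^sup>2)" using var by (simp add: moments)
  then have "0 < ?s" using n by simp
  have "iid_sum_distr M Y n = iid_sum_distr D (\<lambda>t. t) n"
    unfolding D_def by (subst iid_sum_distr_distr) auto
  then have "measure (iid_sum_distr M Y n) {..y * ?s}
      = measure (PiM {..<n} (\<lambda>_. D)) {\<omega> \<in> space (PiM {..<n} (\<lambda>_. D)). (\<Sum>i<n. \<omega> i) / ?s \<le> y}"
    using \<open>0 < ?s\<close> by (simp add: measure_iid_sum_distr pos_divide_le_eq)
  moreover have "\<bar>measure (PiM {..<n} (\<lambda>_. D))
        {\<omega> \<in> space (PiM {..<n} (\<lambda>_. D)). (\<Sum>i<n. \<omega> i) / ?s \<le> y} - Phi y\<bar>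
      \<le> C / sqrt (real n) * lyapunov_ratio D (\<lambda>t. t)"
    using BE[unfolded berry_esseen_const_def, THEN conjunct2, rule_format, of D n y]
      D.prob_space_axioms sets_D integrable moments(1) \<open>0 < D.expectation (\<lambda>t. t\<^sup>2)\<close> n
    unfolding lyapunov_ratio_def by blast
  ultimately show ?thesis
    by (simp add: moments lyapunov_ratio_def)
qed

lemma berry_esseen_upper_tail:
  assumes BE: "berry_esseen_const C" and n: "1 \<le> n"
    and [measurable]: "random_variable borel Y" and mean: "expectation Y = 0"
    and Y3: "integrable M (\<lambda>x. \<bar>Y x\<bar> ^ 3)" and var: "0 < expectation (\<lambda>x. (Y x)\<^sup>2)"
  shows "measure (iid_sum_distr M Y n) {0..}
    \<le> 1 / 2 + C / sqrt (real n) * lyapunov_ratio M Y"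
proof -
  \<comment> \<open>For \<open>- Y\<close> the closed upper tail is a value of the cdf, so an atom at \<open>0\<close> does no harm.\<close>
  have "measure (iid_sum_distr M (\<lambda>x. - Y x) n) {..0} = measure (iid_sum_distr M Y n) {0..}"
    by (auto simp: iid_sum_distr_uminus measure_distr intro!: arg_cong[where f="measure _"])
  then have "\<bar>measure (iid_sum_distr M Y n) {0..} - Phi 0\<bar>
      \<le> C / sqrt (real n) * lyapunov_ratio M Y"
    using berry_esseen_iid_sum[OF BE n, of "\<lambda>x. - Y x" 0] mean Y3 var
    by (simp add: lyapunov_ratio_def)
  then show ?thesis
    using Phi_uminus[of 0] by simp
qed

end

section \<open>Exponential families\<close>

locale exponential_family =
  fixes M :: "real measure" and u v \<eta> \<zeta> :: "real \<Rightarrow> real" and \<Theta> :: "real set"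
  assumes sets_base [measurable_cong]: "sets M = sets borel"
    and u_measurable [measurable]: "u \<in> borel_measurable borel"
    and v_measurable [measurable]: "v \<in> borel_measurable borel"
    and v_nonneg: "0 \<le> v x"
    and normalized: "t \<in> \<Theta> \<Longrightarrow> (\<integral>\<^sup>+ x. ennreal (ef_pdf u v \<eta> \<zeta> t x) \<partial>M) = 1"
    and integrable_u: "t \<in> \<Theta> \<Longrightarrow> integrable (ef_dist M u v \<eta> \<zeta> t) u"
begin

abbreviation law :: "real \<Rightarrow> real measure"
  where "law \<equiv> ef_dist M u v \<eta> \<zeta>"

abbreviation mean :: "real \<Rightarrow> real"
  where "mean \<equiv> ef_mean M u v \<eta> \<zeta>"

abbreviation prob_ge :: "nat \<Rightarrow> real \<Rightarrow> real \<Rightarrow> real"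
  where "prob_ge \<equiv> Pr_ge M u v \<eta> \<zeta>"

abbreviation rho :: "real \<Rightarrow> real \<Rightarrow> real \<Rightarrow> real"
  where "rho \<equiv> ef_rho \<eta> \<zeta>"

abbreviation Delta :: "real \<Rightarrow> nat \<Rightarrow> real \<Rightarrow> real \<Rightarrow> real"
  where "Delta \<equiv> ef_Delta M u v \<eta> \<zeta>"

lemma sets_law [simp, measurable_cong]: "sets (law t) = sets borel"
  by (simp add: ef_dist_def sets_base)

lemma pdf_measurable [measurable]: "ef_pdf u v \<eta> \<zeta> t \<in> borel_measurable borel"
  unfolding ef_pdf_def by measurable

lemma prob_space_law:
  assumes "t \<in> \<Theta>"
  shows "prob_space (law t)"
proof (rule prob_spaceI)
  have "emeasure (law t) (space M) = (\<integral>\<^sup>+ x. ennreal (ef_pdf u v \<eta> \<zeta> t x) \<partial>M)"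
    unfolding ef_dist_def by (subst emeasure_density) (auto intro!: nn_integral_cong)
  then show "emeasure (law t) (space (law t)) = 1"
    using normalized[OF assms] by (simp add: ef_dist_def)
qed

lemma law_eq_exp_tilt: "law t = exp_tilt (law s) (\<lambda>x. u x - z) (\<eta> s - \<eta> t) (rho t z s)"
proof -
  have "ef_pdf u v \<eta> \<zeta> t x = ef_pdf u v \<eta> \<zeta> s x * exp (rho t z s - (\<eta> s - \<eta> t) * (u x - z))" for x
    unfolding ef_pdf_def ef_rho_def by (simp add: mult_exp_exp mult.assoc algebra_simps)
  moreover have "0 \<le> ef_pdf u v \<eta> \<zeta> s x" for x
    using v_nonneg by (simp add: ef_pdf_def)
  ultimately show ?thesis
    unfolding exp_tilt_def ef_dist_def by (subst density_density_eq) (auto simp: ennreal_mult)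
qed

lemma AE_law_iff:
  assumes [measurable]: "Measurable.pred borel P"
  shows "(AE x in law t. P x) \<longleftrightarrow> (AE x in law s. P x)"
  unfolding law_eq_exp_tilt[of t s 0] exp_tilt_def by (subst AE_density) auto

lemma prob_ge_eq_iid_sum:
  assumes "0 < n"
  shows "prob_ge n t z = measure (iid_sum_distr (law t) (\<lambda>x. u x - z) n) {0..}"
  using assms
  by (simp add: Pr_ge_def ef_sample_def Zbar_def measure_iid_sum_distr sum_subtractf
      pos_le_divide_eq mult.commute)

lemma prob_ge_le_1:
  assumes "t \<in> \<Theta>"
  shows "prob_ge n t z \<le> 1"
  unfolding Pr_ge_def ef_sample_def
  by (intro prob_space.prob_le_1 prob_space_PiM prob_space_law assms)

lemma
  assumes "t \<in> \<Theta>"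
  shows integrable_centred: "integrable (law t) (\<lambda>x. u x - z)"
    and integral_centred: "(\<integral>x. u x - z \<partial>law t) = mean t - z"
proof -
  interpret prob_space "law t" using assms by (rule prob_space_law)
  show "integrable (law t) (\<lambda>x. u x - z)" "(\<integral>x. u x - z \<partial>law t) = mean t - z"
    using integrable_u[OF assms] by (simp_all add: ef_mean_def prob_space)
qed

lemma prob_ge_change_of_measure:
  assumes "\<theta> \<in> \<Theta>" "\<alpha> \<in> \<Theta>" "0 < n" and "\<eta> \<theta> \<le> \<eta> \<alpha>"
  shows "prob_ge n \<theta> z \<le> exp (real n * rho \<theta> z \<alpha>) * prob_ge n \<alpha> z"
proof -
  interpret \<alpha>: prob_space "law \<alpha>" using \<open>\<alpha> \<in> \<Theta>\<close> by (rule prob_space_law)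
  have "prob_ge n \<theta> z \<le> exp (real n * rho \<theta> z \<alpha> - (\<eta> \<alpha> - \<eta> \<theta>) * 0) * prob_ge n \<alpha> z"
    unfolding prob_ge_eq_iid_sum[OF \<open>0 < n\<close>] law_eq_exp_tilt[of \<theta> \<alpha> z]
    by (rule \<alpha>.exp_tilt_upper_tail_le)
       (use assms prob_space_law[OF \<open>\<theta> \<in> \<Theta>\<close>] in \<open>simp_all flip: law_eq_exp_tilt\<close>)
  then show ?thesis by simp
qed

lemma prob_ge_mean_le_half_plus_Delta:
  assumes "t \<in> \<Theta>" "1 \<le> n" and "berry_esseen_const C"
  shows "prob_ge n t (mean t) \<le> 1 / 2 + Delta C n t (mean t)"
proof -
  interpret prob_space "law t" using \<open>t \<in> \<Theta>\<close> by (rule prob_space_law)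
  let ?Y = "\<lambda>x. u x - mean t"
  show ?thesis
  proof (cases "integrable (law t) (\<lambda>x. \<bar>?Y x\<bar> ^ 3) \<and> 0 < expectation (\<lambda>x. (?Y x)\<^sup>2)")
    case True
    have "prob_ge n t (mean t) = measure (iid_sum_distr (law t) ?Y n) {0..}"
      using \<open>1 \<le> n\<close> by (intro prob_ge_eq_iid_sum) simp
    also have "\<dots> \<le> 1 / 2 + C / sqrt (real n) * lyapunov_ratio (law t) ?Y"
      using True assms by (intro berry_esseen_upper_tail) (simp_all add: integral_centred)
    finally show ?thesis
      using True prob_ge_le_1[OF \<open>t \<in> \<Theta>\<close>, of n "mean t"]
      by (simp add: ef_Delta_def lyapunov_ratio_def Let_def min_def)
  next
    case False
    then have "Delta C n t (mean t) = 1 / 2"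
      unfolding ef_Delta_def Let_def power2_abs by (rule if_not_P)
    then show ?thesis
      using prob_ge_le_1[OF \<open>t \<in> \<Theta>\<close>, of n "mean t"] by simp
  qed
qed

lemma nondegenerate_if_prob_less_pos:
  assumes "\<theta> \<in> \<Theta>" and pos: "0 < measure (law \<theta>) {x. u x < z}"
  shows "\<not> (AE x in law \<alpha>. u x - z = 0)"
proof
  interpret \<theta>: prob_space "law \<theta>" using \<open>\<theta> \<in> \<Theta>\<close> by (rule prob_space_law)
  assume "AE x in law \<alpha>. u x - z = 0"
  then have "AE x in law \<theta>. u x - z = 0"
    by (subst AE_law_iff[of _ \<theta> \<alpha>]) simp_all
  then have "AE x in law \<theta>. x \<notin> {x. u x < z}"
    by eventually_elim simp
  moreover have "{x. u x < z} \<in> sets (law \<theta>)" by measurable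
  ultimately show False
    using pos \<theta>.prob_eq_0[of "{x. u x < z}"] by simp
qed

lemma eta_le_if_mean_le:
  assumes "\<theta> \<in> \<Theta>" "\<alpha> \<in> \<Theta>" and "mean \<theta> \<le> mean \<alpha>"
    and nondeg: "\<not> (AE x in law \<alpha>. u x - mean \<alpha> = 0)"
  shows "\<eta> \<theta> \<le> \<eta> \<alpha>"
proof (rule ccontr)
  interpret \<alpha>: prob_space "law \<alpha>" using \<open>\<alpha> \<in> \<Theta>\<close> by (rule prob_space_law)
  let ?z = "mean \<alpha>"
  let ?g = "\<lambda>y. exp (rho \<theta> ?z \<alpha> - (\<eta> \<alpha> - \<eta> \<theta>) * y)"
  assume "\<not> \<eta> \<theta> \<le> \<eta> \<alpha>"
  then have "strict_mono ?g"
    by (auto intro!: strict_monoI mult_strict_left_mono_neg)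
  moreover have "integrable (law \<alpha>) (\<lambda>x. ?g (u x - ?z) * (u x - ?z))"
    using integrable_centred[OF \<open>\<theta> \<in> \<Theta>\<close>, of ?z]
    unfolding law_eq_exp_tilt[of \<theta> \<alpha> ?z] exp_tilt_def by (subst (asm) integrable_density) auto
  ultimately have "0 < (\<integral>x. ?g (u x - ?z) * (u x - ?z) \<partial>law \<alpha>)"
    using assms
    by (intro \<alpha>.expectation_mult_strict_mono_pos) (simp_all add: integrable_centred integral_centred)
  also have "\<dots> = (\<integral>x. u x - ?z \<partial>law \<theta>)"
    unfolding law_eq_exp_tilt[of \<theta> \<alpha> ?z] exp_tilt_def by (subst integral_density) auto
  also have "\<dots> = mean \<theta> - ?z"
    by (rule integral_centred) fact
  finally show False using \<open>mean \<theta> \<le> mean \<alpha>\<close> by simp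
qed

theorem prob_ge_chernoff:
  assumes "\<theta> \<in> \<Theta>" "\<alpha> \<in> \<Theta>" "0 < n"
    and "mean \<theta> \<le> mean \<alpha>" "0 < measure (law \<theta>) {x. u x < mean \<alpha>}"
  shows "prob_ge n \<theta> (mean \<alpha>) \<le> exp (real n * rho \<theta> (mean \<alpha>) \<alpha>)"
proof -
  have "\<eta> \<theta> \<le> \<eta> \<alpha>"
    using assms by (intro eta_le_if_mean_le nondegenerate_if_prob_less_pos)
  then have "prob_ge n \<theta> (mean \<alpha>) \<le> exp (real n * rho \<theta> (mean \<alpha>) \<alpha>) * prob_ge n \<alpha> (mean \<alpha>)"
    using assms by (intro prob_ge_change_of_measure)
  also have "\<dots> \<le> exp (real n * rho \<theta> (mean \<alpha>) \<alpha>)"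
    using prob_ge_le_1[OF \<open>\<alpha> \<in> \<Theta>\<close>] by simp
  finally show ?thesis .
qed

theorem prob_ge_log_limit:
  assumes "\<theta> \<in> \<Theta>" "\<alpha> \<in> \<Theta>"
    and "mean \<theta> \<le> mean \<alpha>" "0 < measure (law \<theta>) {x. u x < mean \<alpha>}"
  shows "(\<lambda>n. ln (prob_ge n \<theta> (mean \<alpha>)) / real n) \<longlonglongrightarrow> rho \<theta> (mean \<alpha>) \<alpha>"
proof -
  interpret \<alpha>: prob_space "law \<alpha>" using \<open>\<alpha> \<in> \<Theta>\<close> by (rule prob_space_law)
  let ?Y = "\<lambda>x. u x - mean \<alpha>"
  have nondeg: "\<not> (AE x in law \<alpha>. ?Y x = 0)"
    using assms by (intro nondegenerate_if_prob_less_pos)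
  then have "\<eta> \<theta> \<le> \<eta> \<alpha>"
    using assms by (intro eta_le_if_mean_le)
  have "(\<lambda>n. ln (measure (iid_sum_distr (law \<theta>) ?Y n) {0..}) / real n) \<longlonglongrightarrow> rho \<theta> (mean \<alpha>) \<alpha>"
    unfolding law_eq_exp_tilt[of \<theta> \<alpha> "mean \<alpha>"]
    by (rule \<alpha>.exp_tilt_upper_tail_log_limit)
       (use assms nondeg \<open>\<eta> \<theta> \<le> \<eta> \<alpha>\<close> in
         \<open>simp_all add: integrable_centred integral_centred prob_space_law flip: law_eq_exp_tilt\<close>)
  moreover have "\<forall>\<^sub>F n in sequentially.
      ln (measure (iid_sum_distr (law \<theta>) ?Y n) {0..}) / real n = ln (prob_ge n \<theta> (mean \<alpha>)) / real n"
    using eventually_gt_at_top[of 0] by eventually_elim (simp add: prob_ge_eq_iid_sum)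
  ultimately show ?thesis
    by (rule Lim_transform_eventually)
qed

theorem upper_tail:
  assumes "\<theta> \<in> \<Theta>" "\<alpha> \<in> \<Theta>" "1 \<le> n" and "berry_esseen_const C" and z: "z = mean \<alpha>"
  shows "mean \<theta> \<le> z \<and> 0 < measure (law \<theta>) {x. u x < z} \<longrightarrow>
      prob_ge n \<theta> z \<le> exp (real n * rho \<theta> z \<alpha>) \<and>
      (\<lambda>m. ln (prob_ge m \<theta> z) / real m) \<longlonglongrightarrow> rho \<theta> z \<alpha>"
    and "\<eta> \<theta> \<le> \<eta> \<alpha> \<longrightarrow>
      prob_ge n \<theta> z \<le> exp (real n * rho \<theta> z \<alpha>) * prob_ge n \<alpha> z \<and>
      exp (real n * rho \<theta> z \<alpha>) * prob_ge n \<alpha> z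
        \<le> (1 / 2 + Delta C n \<alpha> z) * exp (real n * rho \<theta> z \<alpha>)"
proof -
  have "0 < n" using \<open>1 \<le> n\<close> by simp
  then show "mean \<theta> \<le> z \<and> 0 < measure (law \<theta>) {x. u x < z} \<longrightarrow>
      prob_ge n \<theta> z \<le> exp (real n * rho \<theta> z \<alpha>) \<and>
      (\<lambda>m. ln (prob_ge m \<theta> z) / real m) \<longlonglongrightarrow> rho \<theta> z \<alpha>"
    unfolding z using prob_ge_chernoff prob_ge_log_limit assms by blast
  have "prob_ge n \<alpha> z \<le> 1 / 2 + Delta C n \<alpha> z"
    unfolding z using assms by (intro prob_ge_mean_le_half_plus_Delta)
  then show "\<eta> \<theta> \<le> \<eta> \<alpha> \<longrightarrow>
      prob_ge n \<theta> z \<le> exp (real n * rho \<theta> z \<alpha>) * prob_ge n \<alpha> z \<and>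
      exp (real n * rho \<theta> z \<alpha>) * prob_ge n \<alpha> z
        \<le> (1 / 2 + Delta C n \<alpha> z) * exp (real n * rho \<theta> z \<alpha>)"
    using prob_ge_change_of_measure assms \<open>0 < n\<close> by simp
qed

end

lemma ef_dist_uminus: "ef_dist M (\<lambda>x. - u x) v (\<lambda>t. - \<eta> t) \<zeta> = ef_dist M u v \<eta> \<zeta>"
  by (simp add: ef_dist_def ef_pdf_def fun_eq_iff)

lemma ef_mean_uminus: "ef_mean M (\<lambda>x. - u x) v (\<lambda>t. - \<eta> t) \<zeta> t = - ef_mean M u v \<eta> \<zeta> t"
  by (simp add: ef_mean_def ef_dist_uminus)

lemma Pr_ge_uminus: "Pr_ge M (\<lambda>x. - u x) v (\<lambda>t. - \<eta> t) \<zeta> n t (- z) = Pr_le M u v \<eta> \<zeta> n t z"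
  by (simp add: Pr_ge_def Pr_le_def ef_sample_def ef_dist_uminus Zbar_def sum_negf)

lemma ef_rho_uminus: "ef_rho (\<lambda>t. - \<eta> t) \<zeta> t (- z) a = ef_rho \<eta> \<zeta> t z a"
  by (simp add: ef_rho_def algebra_simps)

lemma ef_Delta_uminus:
  "ef_Delta M (\<lambda>x. - u x) v (\<lambda>t. - \<eta> t) \<zeta> C n t (- z) = ef_Delta M u v \<eta> \<zeta> C n t z"
  by (simp add: ef_Delta_def ef_dist_uminus abs_minus_commute[of z])

lemmas ef_uminus = ef_dist_uminus ef_mean_uminus Pr_ge_uminus ef_rho_uminus ef_Delta_uminus

lemma (in exponential_family) exponential_family_uminus:
  "exponential_family M (\<lambda>x. - u x) v (\<lambda>t. - \<eta> t) \<zeta> \<Theta>"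
  using sets_base v_nonneg normalized integrable_u
  by unfold_locales (simp_all add: ef_dist_uminus ef_pdf_def)

theorem theorem5:
  fixes M :: "real measure" and u v \<eta> \<zeta> :: "real \<Rightarrow> real" and \<Theta> :: "real set"
    and \<theta> \<alpha> z C :: real and n :: nat
  assumes base: "M = lborel \<or> (\<exists>S. countable S \<and> M = distr (count_space S) borel (\<lambda>x. x))"
    and u_meas: "u \<in> borel_measurable borel" and v_meas: "v \<in> borel_measurable borel"
    and v_nonneg: "\<forall>x. v x \<ge> 0"
    and normalized: "\<forall>t\<in>\<Theta>. (\<integral>\<^sup>+ x. ennreal (ef_pdf u v \<eta> \<zeta> t x) \<partial>M) = 1"
    and mean_exists: "\<forall>t\<in>\<Theta>. integrable (ef_dist M u v \<eta> \<zeta> t) u"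
    and eta_diff: "\<eta> differentiable_on \<Theta>" and zeta_diff: "\<zeta> differentiable_on \<Theta>"
    and theta: "\<theta> \<in> \<Theta>" and alpha: "\<alpha> \<in> \<Theta>"
    and z_def: "z = ef_mean M u v \<eta> \<zeta> \<alpha>"
    and BE: "berry_esseen_const C"
    and n: "n \<ge> 1"
  shows
   "(ef_mean M u v \<eta> \<zeta> \<theta> \<le> z \<and> measure (ef_dist M u v \<eta> \<zeta> \<theta>) {x. u x < z} > 0 \<longrightarrow>
       Pr_ge M u v \<eta> \<zeta> n \<theta> z \<le> exp (real n * ef_rho \<eta> \<zeta> \<theta> z \<alpha>) \<and>
       (\<lambda>m. ln (Pr_ge M u v \<eta> \<zeta> m \<theta> z) / real m) \<longlonglongrightarrow> ef_rho \<eta> \<zeta> \<theta> z \<alpha>)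
  \<and> (ef_mean M u v \<eta> \<zeta> \<theta> \<ge> z \<and> measure (ef_dist M u v \<eta> \<zeta> \<theta>) {x. u x > z} > 0 \<longrightarrow>
       Pr_le M u v \<eta> \<zeta> n \<theta> z \<le> exp (real n * ef_rho \<eta> \<zeta> \<theta> z \<alpha>) \<and>
       (\<lambda>m. ln (Pr_le M u v \<eta> \<zeta> m \<theta> z) / real m) \<longlonglongrightarrow> ef_rho \<eta> \<zeta> \<theta> z \<alpha>)
  \<and> (\<eta> \<theta> \<le> \<eta> \<alpha> \<longrightarrow>
       Pr_ge M u v \<eta> \<zeta> n \<theta> z \<le> exp (real n * ef_rho \<eta> \<zeta> \<theta> z \<alpha>) * Pr_ge M u v \<eta> \<zeta> n \<alpha> z \<and>
       exp (real n * ef_rho \<eta> \<zeta> \<theta> z \<alpha>) * Pr_ge M u v \<eta> \<zeta> n \<alpha> z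
         \<le> (1/2 + ef_Delta M u v \<eta> \<zeta> C n \<alpha> z) * exp (real n * ef_rho \<eta> \<zeta> \<theta> z \<alpha>))
  \<and> (\<eta> \<theta> \<ge> \<eta> \<alpha> \<longrightarrow>
       Pr_le M u v \<eta> \<zeta> n \<theta> z \<le> exp (real n * ef_rho \<eta> \<zeta> \<theta> z \<alpha>) * Pr_le M u v \<eta> \<zeta> n \<alpha> z \<and>
       exp (real n * ef_rho \<eta> \<zeta> \<theta> z \<alpha>) * Pr_le M u v \<eta> \<zeta> n \<alpha> z
         \<le> (1/2 + ef_Delta M u v \<eta> \<zeta> C n \<alpha> z) * exp (real n * ef_rho \<eta> \<zeta> \<theta> z \<alpha>))"
proof -
  have "sets M = sets borel"
    using base by auto
  then interpret upper: exponential_family M u v \<eta> \<zeta> \<Theta>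
    using u_meas v_meas v_nonneg normalized mean_exists by unfold_locales auto
  interpret lower: exponential_family M "\<lambda>x. - u x" v "\<lambda>t. - \<eta> t" \<zeta> \<Theta>
    by (rule upper.exponential_family_uminus)
  have "- z = lower.mean \<alpha>"
    using z_def by (simp add: ef_mean_uminus)
  note lower_tail = lower.upper_tail[OF theta alpha n BE this, unfolded ef_uminus]
  show ?thesis
    using upper.upper_tail[OF theta alpha n BE z_def] lower_tail by simp
qed

end
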